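(* A $q$-difference equation of the hypergeometric type $$(a_0+b_0x)\,u(xq^2)+(a_1+b_1x)\,u(xq)+(a_2+b_2x)\,u(x)=0 \qquad ( * )$$ with constants $a_0,a_1,a_2,b_0,b_1,b_2$ reduces to one of the following equations, with parameters $a,b,c$ or $\nu$, by the transformations (1)-(4) listed in the context. (1) When $a_0a_2b_0b_2\neq0$, Heine's hypergeometric ${}_2\varphi_1(a,b;c;q,x)$: $$(c-abqx)u(xq^2)-[c+q-(a+b)qx]u(xq)+q(1-x)u(x)=0.$$ (2) When $b_2=0$, $a_0a_2b_0b_1\neq0$, ${}_1\varphi_1(a;c;q,x)$: $$(c-aqx)u(xq^2)-(c+q-qx)u(xq)+q\,u(x)=0.$$ (3-1) When $b_0=b_1=0$, $a_0a_1a_2b_2\neq0$, Jackson's Bessel function $E^{(1)}_\nu(x;q)$: $$u(xq^2)-(q^\nu+q^{-\nu})u(xq)+(1+x/4)u(x)=0.$$ (3-2) When $b_0=b_2=0$, $a_0a_1a_2b_1\neq0$, Hahn-Exton's Bessel function $E^{(3)}_\nu(x;q)$: $$u(xq^2)+[-(q^\nu+q^{-\nu})+q^{2-\nu}x]u(xq)+u(x)=0.$$ (3-3) When $b_2=a_0=0$, $a_1a_2b_0b_1\neq0$, the $q$-Hermite-Weber function ${}_1\varphi_1(a;0;q,x)$: $$a x\,u(xq^2)+(1-x)u(xq)-u(x)=0.$$ (4-1) When $b_0=a_1=b_2=0$, the $q$-Airy function ${}_1\varphi_1(0;-q;q,-x)$: $$u(xq^2)+x\,u(xq)-u(x)=0.$$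 (4-2) When $a_0=b_1=b_2=0$, the Ramanujan function ${}_0\varphi_1(-;0;q,-qx)$: $$qx\,u(xq^2)-u(xq)+u(x)=0.$$
   Context: Here $0<|q|<1$. Notation: $(a;q)_0=1$, $(a;q)_n=\prod_{k=0}^{n-1}(1-aq^k)$, $(a;q)_\infty=\prod_{k\ge0}(1-aq^k)$, $(a_1,\dots,a_r;q)_n=\prod_{i=1}^r(a_i;q)_n$, and $${}_r\varphi_s(a_1,\dots,a_r;b_1,\dots,b_s;q,z)=\sum_{n\ge0}\frac{(a_1,\dots,a_r;q)_n}{(b_1,\dots,b_s;q)_n(q;q)_n}\left[(-1)^nq^{n(n-1)/2}\right]^{1+s-r}z^n.$$ The theta function is $\theta_q(x)=\sum_{n\in\mathbb{Z}}q^{n(n-1)/2}x^n$, and $x\theta_q(qx)=\theta_q(x)$. The $q$-Bessel functions are $E^{(1)}_\nu(x;q)=x^\nu{}_2\varphi_1(0,0;q^{2\nu+1};q,-x/4)$ and $E^{(3)}_\nu(x;q)=x^\nu{}_1\varphi_1(0;q^{2\nu+1};q,q^2x)$. The function named in each case is a solution of the displayed equation. A $q$-difference equation is of the hypergeometric type if it is of second order with coefficients linear in $x$, i.e. of the form $( * )$. The transformations, which keep the hypergeometric type, are: (1) $x\to cx$; (2) $u\to x^\gamma u$; (3) $x\to1/x$; (4) $u\to\frac{(\rho_2x;q)_\infty}{(x/(\rho_1q);q)_\infty}u$, where $\rho_1=-a_0/b_0$ and $\rho_2=-b_2/a_2$. When some of the exponents (the roots of $a_0\mu^2+a_1\mu+a_2=0$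 and of $b_0+b_1\lambda+b_2\lambda^2=0$, together with $\rho_1,\rho_2$) are zero or infinite, $\theta_q(sx)$ is taken instead of $(sx;q)_\infty$ in (4).
   Formalization: Excluded, since the claim fails there: equations with all b_i=0 or all a_i=0 (constant coefficients, up to a factor x), and the two-term equations b_0x u(xq^2)+a_2u(x)=0 and a_0u(xq^2)+b_2x u(x)=0; so b_1≠0 in (4-1) and a_1≠0 in (4-2). *)

theory Defs
  imports "HOL-Analysis.Analysis"
begin

definition qpoch :: "complex \<Rightarrow> complex \<Rightarrow> nat \<Rightarrow> complex" where
  "qpoch a q n = (\<Prod>k<n. 1 - a * q ^ k)"

definition qpoch_inf :: "complex \<Rightarrow> complex \<Rightarrow> complex" where
  "qpoch_inf a q = prodinf (\<lambda>k. 1 - a * q ^ k)"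

definition qphi :: "complex list \<Rightarrow> complex list \<Rightarrow> complex \<Rightarrow> complex \<Rightarrow> complex" where
  "qphi as bs q z =
     (\<Sum>n. prod_list (map (\<lambda>a. qpoch a q n) as)
            / (prod_list (map (\<lambda>b. qpoch b q n) bs) * qpoch q q n)
          * ((-1) ^ n * q ^ (n * (n - 1) div 2)) powi (1 + int (length bs) - int (length as))
          * z ^ n)"

definition qtheta :: "complex \<Rightarrow> complex \<Rightarrow> complex" where
  "qtheta q x = (\<Sum>\<^sub>\<infinity>n\<in>(UNIV :: int set). q powi (n * (n - 1) div 2) * x powi n)"

text \<open>
  Powers \<open>x\<^sup>\<gamma>\<close> make the unknown functions multivalued in \<open>x \<noteq> 0\<close>. They are therefore
  functions of the logarithmic variable \<open>t\<close>, where \<open>x = exp t\<close>: then \<open>x\<^sup>\<gamma>\<close> is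
  \<open>exp (\<gamma> * t)\<close>, and \<open>x \<mapsto> x q\<close> is \<open>t \<mapsto> t + Ln q\<close>, so that \<open>(x q)\<^sup>\<gamma> = x\<^sup>\<gamma> q\<^sup>\<gamma>\<close> holds with
  \<open>q\<^sup>\<gamma> = q powr \<gamma>\<close>.
\<close>

definition bessel_E1 :: "complex \<Rightarrow> complex \<Rightarrow> complex \<Rightarrow> complex" where
  "bessel_E1 q \<nu> t = exp (\<nu> * t) * qphi [0, 0] [q powr (2 * \<nu> + 1)] q (- exp t / 4)"

definition bessel_E3 :: "complex \<Rightarrow> complex \<Rightarrow> complex \<Rightarrow> complex" where
  "bessel_E3 q \<nu> t = exp (\<nu> * t) * qphi [0] [q powr (2 * \<nu> + 1)] q (q\<^sup>2 * exp t)"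

text \<open>
  \<open>QEq a0 b0 a1 b1 a2 b2\<close> stands for
  \<open>(a0 + b0 x) u(x q\<^sup>2) + (a1 + b1 x) u(x q) + (a2 + b2 x) u(x) = 0\<close>.
\<close>

datatype qeq = QEq complex complex complex complex complex complex

fun qeq_lhs :: "complex \<Rightarrow> qeq \<Rightarrow> (complex \<Rightarrow> complex) \<Rightarrow> complex \<Rightarrow> complex" where
  "qeq_lhs q (QEq a0 b0 a1 b1 a2 b2) u t =
     (a0 + b0 * exp t) * u (t + 2 * Ln q) + (a1 + b1 * exp t) * u (t + Ln q)
       + (a2 + b2 * exp t) * u t"

definition solves_on :: "complex \<Rightarrow> complex set \<Rightarrow> qeq \<Rightarrow> (complex \<Rightarrow> complex) \<Rightarrow> bool" where
  "solves_on q S E u \<longleftrightarrow> (\<forall>t\<in>S. qeq_lhs q E u t = 0)"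

fun second_order :: "qeq \<Rightarrow> bool" where
  "second_order (QEq a0 b0 a1 b1 a2 b2) \<longleftrightarrow> (a0 \<noteq> 0 \<or> b0 \<noteq> 0) \<and> (a2 \<noteq> 0 \<or> b2 \<noteq> 0)"

text \<open>
  Among the second-order equations, this excludes the constant-coefficient ones (possibly after
  division by \<open>x\<close>) and the two-term ones \<open>b0 x u(x q\<^sup>2) + a2 u(x) = 0\<close> and
  \<open>a0 u(x q\<^sup>2) + b2 x u(x) = 0\<close>, which are first-order equations in the base \<open>q\<^sup>2\<close>. Both classes
  are stable under the transformations below and contain none of the target equations.
\<close>

fun nondegenerate :: "qeq \<Rightarrow> bool" where
  "nondegenerate (QEq a0 b0 a1 b1 a2 b2) \<longleftrightarrow>
     \<not> (b0 = 0 \<and> b1 = 0 \<and> b2 = 0) \<and> \<not> (a0 = 0 \<and> a1 = 0 \<and> a2 = 0) \<and>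
     \<not> (a1 = 0 \<and> b1 = 0 \<and> a0 = 0 \<and> b2 = 0) \<and> \<not> (a1 = 0 \<and> b1 = 0 \<and> b0 = 0 \<and> a2 = 0)"

text \<open>
  The change of unknown \<open>u \<mapsto> \<Phi> u\<close> turns the equation \<open>E\<close> into the equation \<open>E'\<close>. As \<open>u\<close> ranges
  over arbitrary functions of \<open>t\<close>, the solutions determine a second-order equation up to a
  common factor of its coefficients.
\<close>

definition transforms_on ::
    "complex \<Rightarrow> complex set \<Rightarrow> ((complex \<Rightarrow> complex) \<Rightarrow> complex \<Rightarrow> complex) \<Rightarrow> qeq \<Rightarrow> qeq \<Rightarrow> bool" where
  "transforms_on q S \<Phi> E E' \<longleftrightarrow> (\<forall>u. solves_on q S E u \<longleftrightarrow> solves_on q S E' (\<Phi> u))"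

text \<open>
  The factor \<open>(\<rho>\<^sub>2 x; q)\<^sub>\<infinity> / (x / (\<rho>\<^sub>1 q); q)\<^sub>\<infinity>\<close> with \<open>\<rho>\<^sub>1 = - a0 / b0\<close> and \<open>\<rho>\<^sub>2 = - b2 / a2\<close>.
  If \<open>\<rho>\<^sub>2 = \<infinity>\<close> (\<open>a2 = 0\<close>), respectively \<open>\<rho>\<^sub>1 = 0\<close> (\<open>a0 = 0\<close>), the product in question is not
  defined, and \<open>\<theta>\<^sub>q(s x)\<close>, respectively \<open>\<theta>\<^sub>q(r x)\<close>, takes its place. If \<open>\<rho>\<^sub>2 = 0\<close>, respectively
  \<open>\<rho>\<^sub>1 = \<infinity>\<close>, the product is \<open>(0; q)\<^sub>\<infinity> = 1\<close>.
\<close>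

fun gauge_factor :: "complex \<Rightarrow> complex \<Rightarrow> complex \<Rightarrow> qeq \<Rightarrow> complex \<Rightarrow> complex" where
  "gauge_factor q s r (QEq a0 b0 a1 b1 a2 b2) t =
     (if a2 = 0 then qtheta q (s * exp t) else qpoch_inf (- b2 / a2 * exp t) q)
     / (if a0 = 0 then qtheta q (r * exp t) else qpoch_inf (- b0 / (a0 * q) * exp t) q)"

text \<open>
  Points whose \<open>q\<close>-orbit meets no zero and no pole of \<open>h\<close>, given as a quotient; at a pole the
  value of the quotient is \<open>0\<close>.
\<close>

definition regular_set :: "complex \<Rightarrow> (complex \<Rightarrow> complex) \<Rightarrow> complex set" where
  "regular_set q h = {t. \<forall>k::int. h (t + of_int k * Ln q) \<noteq> 0}"

inductive qstep :: "complex \<Rightarrow> qeq \<Rightarrow> qeq \<Rightarrow> bool" for q :: complex where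
  scale: "transforms_on q UNIV (\<lambda>u t. u (t + \<kappa>)) E E' \<Longrightarrow> qstep q E E'"  \<comment> \<open>\<open>x \<rightarrow> c x\<close>, \<open>c = exp \<kappa>\<close>\<close>
| power: "transforms_on q UNIV (\<lambda>u t. exp (\<gamma> * t) * u t) E E' \<Longrightarrow> qstep q E E'"
| invert: "transforms_on q UNIV (\<lambda>u t. u (- t)) E E' \<Longrightarrow> qstep q E E'"
| gauge: "s \<noteq> 0 \<Longrightarrow> r \<noteq> 0 \<Longrightarrow> h = gauge_factor q s r E \<Longrightarrow>
    transforms_on q (regular_set q h) (\<lambda>u t. h t * u t) E E' \<Longrightarrow> qstep q E E'"

definition reduces :: "complex \<Rightarrow> qeq \<Rightarrow> qeq \<Rightarrow> bool" where
  "reduces q = (qstep q)\<^sup>*\<^sup>*"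

definition heine_eq :: "complex \<Rightarrow> complex \<Rightarrow> complex \<Rightarrow> complex \<Rightarrow> qeq" where
  "heine_eq q a b c = QEq c (- (a * b * q)) (- (c + q)) ((a + b) * q) q (- q)"

definition phi11_eq :: "complex \<Rightarrow> complex \<Rightarrow> complex \<Rightarrow> qeq" where
  "phi11_eq q a c = QEq c (- (a * q)) (- (c + q)) q q 0"

definition bessel_E1_eq :: "complex \<Rightarrow> complex \<Rightarrow> qeq" where
  "bessel_E1_eq q \<nu> = QEq 1 0 (- (q powr \<nu> + q powr (- \<nu>))) 0 1 (1 / 4)"

definition bessel_E3_eq :: "complex \<Rightarrow> complex \<Rightarrow> qeq" where
  "bessel_E3_eq q \<nu> = QEq 1 0 (- (q powr \<nu> + q powr (- \<nu>))) (q powr (2 - \<nu>)) 1 0"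

definition hermite_weber_eq :: "complex \<Rightarrow> qeq" where
  "hermite_weber_eq a = QEq 0 a 1 (- 1) (- 1) 0"

definition airy_eq :: qeq where
  "airy_eq = QEq 1 0 0 1 (- 1) 0"

definition ramanujan_eq :: "complex \<Rightarrow> qeq" where
  "ramanujan_eq q = QEq 0 q (- 1) 0 1 0"

end

theory Submission
  imports Defs
begin

text \<open>
  Up to a common factor, \<open>x \<rightarrow> c x\<close> multiplies the row \<open>(b0, b1, b2)\<close> by \<open>c\<close>, and \<open>u \<rightarrow> x\<^sup>\<gamma> u\<close>
  multiplies the columns by \<open>p\<^sup>2, p, 1\<close>. These two steps suffice for every case of the list:
  \<open>p\<close> makes \<open>1\<close> an exponent at \<open>0\<close>, or equalizes the outer coefficients for the Bessel functions.
  The zero patterns outside the list are brought into it by \<open>x \<rightarrow> 1 / x\<close>, which exchanges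
  \<open>(a0, a1, a2)\<close> with \<open>(b2, b1, b0)\<close>, and by the gauge transformation, which exchanges
  \<open>b0\<close> with \<open>b2\<close> (infinite products) or turns \<open>a0, b2\<close> into \<open>b0, a2\<close> (theta function).
\<close>

section \<open>Basic hypergeometric series\<close>

definition qphi_coeff :: "complex list \<Rightarrow> complex list \<Rightarrow> complex \<Rightarrow> nat \<Rightarrow> complex" where
  "qphi_coeff as bs q n = prod_list (map (\<lambda>a. qpoch a q n) as)
     / (prod_list (map (\<lambda>b. qpoch b q n) bs) * qpoch q q n)
     * ((-1) ^ n * q ^ (n * (n - 1) div 2)) powi (1 + int (length bs) - int (length as))"

lemma qphi_eq_suminf: "qphi as bs q z = (\<Sum>n. qphi_coeff as bs q n * z ^ n)"
  by (simp add: qphi_def qphi_coeff_def)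

lemma qpoch_Suc: "qpoch a q (Suc n) = qpoch a q n * (1 - a * q ^ n)"
  by (simp add: qpoch_def)

lemma prod_list_qpoch_Suc:
  "prod_list (map (\<lambda>a. qpoch a q (Suc n)) as)
     = prod_list (map (\<lambda>a. qpoch a q n) as) * prod_list (map (\<lambda>a. 1 - a * q ^ n) as)"
  by (induction as) (simp_all add: qpoch_Suc)

lemma triangular_Suc: "Suc n * (Suc n - 1) div 2 = n * (n - 1) div 2 + n"
proof -
  have "Suc n * (Suc n - 1) = n * (n - 1) + n * 2"
    by (cases n) auto
  then show ?thesis by simp
qed

text \<open>Keeps the factors \<open>1 - q * q ^ n\<close> of the denominator
  \<open>qpoch q q n\<close> away from zero.\<close>

lemma power_eq_one_norm_less:
  fixes q :: complex
  assumes "norm q < 1" "q ^ Suc n = 1"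
  shows False
proof -
  have "norm q ^ Suc n = 1" using assms(2) by (metis norm_one norm_power)
  moreover have "norm q ^ Suc n < 1" using assms(1) by (simp add: power_less_one_iff del: power_Suc)
  ultimately show False by simp
qed

text \<open>The ratio of consecutive coefficients is rational in \<open>q ^ n\<close>; it is
  cross-multiplied here so that it can be matched with polynomial identities. The natural number
  \<open>d\<close> equals \<open>1 + s - r\<close>, which turns the integer power into an ordinary
  one.\<close>

lemma qphi_coeff_Suc:
  assumes q: "norm q < 1" and len: "length bs + 1 = length as + d"
    and b: "\<And>b k. b \<in> set bs \<Longrightarrow> b * q ^ k \<noteq> 1"
  shows "qphi_coeff as bs q (Suc n) * ((1 - q * q ^ n) * prod_list (map (\<lambda>b. 1 - b * q ^ n) bs))
    = qphi_coeff as bs q n * (prod_list (map (\<lambda>a. 1 - a * q ^ n) as) * (- (q ^ n)) ^ d)"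
proof -
  have d: "1 + int (length bs) - int (length as) = int d"
    using len by linarith
  have 1: "1 - q * q ^ n \<noteq> 0"
    using power_eq_one_norm_less[OF q, of n] by auto
  have 2: "prod_list (map (\<lambda>b. 1 - b * q ^ n) bs) \<noteq> 0"
    using b by (force simp: prod_list_zero_iff)
  have 3: "(-1) ^ Suc n * q ^ (Suc n * (Suc n - 1) div 2)
      = ((-1) ^ n * q ^ (n * (n - 1) div 2)) * (- (q ^ n))"
    unfolding triangular_Suc by (simp add: power_add)
  show ?thesis
    unfolding qphi_coeff_def prod_list_qpoch_Suc qpoch_Suc[of q q n] d power_int_of_nat 3 power_mult_distrib[of _ "- (q ^ n)"]
    using 1 2 by (simp add: divide_simps)
qed

lemma tendsto_prod_list_qpoch_factor:
  fixes q :: complex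
  assumes "norm q < 1"
  shows "(\<lambda>n. prod_list (map (\<lambda>a. 1 - a * q ^ n) as)) \<longlonglongrightarrow> 1"
proof (induction as)
  case (Cons a as)
  have "(\<lambda>n. 1 - a * q ^ n) \<longlonglongrightarrow> 1 - a * 0"
    by (intro tendsto_intros LIMSEQ_power_zero assms)
  from tendsto_mult[OF this Cons.IH] show ?case by simp
qed simp

text \<open>Ratio test: the quotient \<open>R n\<close> of consecutive terms tends to
  \<open>z * 0 ^ d\<close>. Hence the series converges everywhere for \<open>d > 0\<close> and in
  the unit disc for \<open>d = 0\<close>.\<close>

lemma summable_qphi:
  assumes q: "norm q < 1" and len: "length bs + 1 = length as + d"
    and b: "\<And>b k. b \<in> set bs \<Longrightarrow> b * q ^ k \<noteq> 1"
    and z: "d = 0 \<Longrightarrow> norm z < 1"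
  shows "summable (\<lambda>n. qphi_coeff as bs q n * z ^ n)"
proof -
  define R where "R n = z * (prod_list (map (\<lambda>a. 1 - a * q ^ n) as) * (- (q ^ n)) ^ d)
    / ((1 - q * q ^ n) * prod_list (map (\<lambda>b. 1 - b * q ^ n) bs))" for n
  have q0: "(\<lambda>n. q ^ n) \<longlonglongrightarrow> 0" by (intro LIMSEQ_power_zero q)
  have "R \<longlonglongrightarrow> z * (1 * (- 0) ^ d) / ((1 - q * 0) * 1)"
    unfolding R_def
    by (intro tendsto_intros tendsto_prod_list_qpoch_factor q q0) simp
  then have lim: "(\<lambda>n. norm (R n)) \<longlonglongrightarrow> norm (z * 0 ^ d)"
    by (intro tendsto_norm) simp
  \<comment> \<open>Since \<open>0 ^ 0 = 1\<close>, this bound is \<open>norm z < 1\<close> for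
    \<open>d = 0\<close>; for \<open>d > 0\<close> the limit is 0.\<close>
  have "norm (z * 0 ^ d) < 1"
    using z by (cases d) auto
  then obtain \<rho> where \<rho>: "norm (z * 0 ^ d) < \<rho>" "\<rho> < 1"
    using dense by blast
  with lim have "eventually (\<lambda>n. norm (R n) < \<rho>) sequentially"
    by (auto dest: order_tendstoD(2))
  then obtain N where N: "\<And>n. n \<ge> N \<Longrightarrow> norm (R n) < \<rho>"
    by (auto simp: eventually_sequentially)
  have step: "qphi_coeff as bs q (Suc n) * z ^ Suc n = R n * (qphi_coeff as bs q n * z ^ n)" for n
  proof -
    let ?D = "(1 - q * q ^ n) * prod_list (map (\<lambda>b. 1 - b * q ^ n) bs)"
    let ?N = "prod_list (map (\<lambda>a. 1 - a * q ^ n) as) * (- (q ^ n)) ^ d"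
    have D: "?D \<noteq> 0"
      using power_eq_one_norm_less[OF q, of n] b by (force simp: prod_list_zero_iff)
    then have R: "R n * ?D = z * ?N"
      by (simp add: R_def)
    have "qphi_coeff as bs q (Suc n) * z ^ Suc n * ?D = z ^ Suc n * (qphi_coeff as bs q (Suc n) * ?D)"
      by (simp only: mult_ac)
    also have "\<dots> = z * ?N * (qphi_coeff as bs q n * z ^ n)"
      by (subst qphi_coeff_Suc[OF q len b]) (simp_all add: mult_ac)
    also have "\<dots> = R n * (qphi_coeff as bs q n * z ^ n) * ?D"
      unfolding R[symmetric] by (simp only: mult_ac)
    finally show ?thesis
      using D by (simp only: mult_cancel_right simp_thms)
  qed
  show ?thesis
  proof (rule summable_ratio_test[OF \<rho>(2)])
    fix n assume "N \<le> n"
    then show "norm (qphi_coeff as bs q (Suc n) * z ^ Suc n)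
        \<le> \<rho> * norm (qphi_coeff as bs q n * z ^ n)"
      unfolding step norm_mult[of "R n"] using N[of n] by (intro mult_right_mono) auto
  qed
qed

text \<open>
  The polynomial identities in \<open>y\<close> compare the coefficients of \<open>x\<^sup>n\<^sup>+\<^sup>1\<close>, with \<open>y = q\<^sup>n\<close>;
  the value \<open>y = 1 / q\<close> gives the coefficient of \<open>x\<^sup>0\<close>.
\<close>

lemma qphi_solves:
  assumes q: "0 < norm q" "norm q < 1" and len: "length bs + 1 = length as + d"
    and b: "\<And>b k. b \<in> set bs \<Longrightarrow> b * q ^ k \<noteq> 1"
    and A: "\<And>y. a0 * (q * y)\<^sup>2 + a1 * (q * y) + a2
              = \<mu> * ((1 - q * y) * prod_list (map (\<lambda>b. 1 - b * y) bs))"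
    and B: "\<And>y. b0 * y\<^sup>2 + b1 * y + b2
              = - \<mu> * \<kappa> * (prod_list (map (\<lambda>a. 1 - a * y) as) * (- y) ^ d)"
    and S: "\<And>t. t \<in> S \<Longrightarrow> d = 0 \<Longrightarrow> norm (\<kappa> * exp t) < 1"
  shows "solves_on q S (QEq a0 b0 a1 b1 a2 b2) (\<lambda>t. qphi as bs q (\<kappa> * exp t))"
  unfolding solves_on_def
proof
  fix t assume t: "t \<in> S"
  define x where "x = exp t"
  define c where "c n = qphi_coeff as bs q n * \<kappa> ^ n" for n
  have q0: "q \<noteq> 0" using q by auto
  have e1: "exp (t + Ln q) = q * x" and e2: "exp (t + 2 * Ln q) = q\<^sup>2 * x"
    using q0 by (simp_all add: x_def exp_add exp_double)
  have sm: "summable (\<lambda>n. c n * (y * x) ^ n)" if "norm y \<le> 1" for y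
  proof -
    \<comment> \<open>The shifts multiply \<open>x\<close> by \<open>q\<close> or
      \<open>q\<^sup>2\<close>, which moves it towards 0, so the bound at \<open>t\<close> covers
      all three points of the equation.\<close>
    have "norm (\<kappa> * (y * x)) < 1" if "d = 0"
    proof -
      have "norm (\<kappa> * (y * x)) = norm y * norm (\<kappa> * x)"
        by (simp add: norm_mult)
      also have "\<dots> \<le> 1 * norm (\<kappa> * x)"
        by (intro mult_right_mono \<open>norm y \<le> 1\<close>) auto
      finally show ?thesis using S[OF t that] by (simp add: x_def)
    qed
    from summable_qphi[OF q(2) len b this] show ?thesis
      by (simp add: c_def power_mult_distrib mult_ac)
  qed
  define F where "F y = (\<Sum>n. c n * (y * x) ^ n)" for y
  have F: "qphi as bs q (\<kappa> * (y * x)) = F y" for y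
    unfolding F_def qphi_eq_suminf c_def by (simp add: power_mult_distrib mult_ac)
  have sums: "(\<lambda>n. c n * (y * x) ^ n) sums F y" if "norm y \<le> 1" for y
    unfolding F_def using sm[OF that] by (rule summable_sums)
  have n1: "norm q \<le> 1" and n2: "norm (q\<^sup>2) \<le> 1" and n0: "norm (1::complex) \<le> 1"
    using q(2) by (auto simp: norm_power power_le_one)
  \<comment> \<open>Replacing \<open>x\<close> by \<open>q x\<close> multiplies the n-th term by
    \<open>q ^ n\<close>. So \<alpha> collects the terms from the constant parts of the
    coefficients, \<beta> those from the parts linear in \<open>x\<close>, and the equation says
    that the sum of \<alpha> plus \<open>x\<close> times the sum of \<beta> is zero.\<close>
  define \<alpha> where "\<alpha> n = (a0 * (q ^ n)\<^sup>2 + a1 * q ^ n + a2) * c n * x ^ n" for n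
  define \<beta> where "\<beta> n = (b0 * (q ^ n)\<^sup>2 + b1 * q ^ n + b2) * c n * x ^ n" for n
  have \<alpha>: "\<alpha> sums (a0 * F (q\<^sup>2) + a1 * F q + a2 * F 1)"
  proof -
    have "(\<lambda>n. a0 * (c n * (q\<^sup>2 * x) ^ n) + a1 * (c n * (q * x) ^ n) + a2 * (c n * (1 * x) ^ n))
        sums (a0 * F (q\<^sup>2) + a1 * F q + a2 * F 1)"
      by (intro sums_add sums_mult sums n0 n1 n2)
    then show ?thesis
      unfolding \<alpha>_def
      by (rule sums_cong[THEN iffD1, rotated])
         (simp add: algebra_simps power_mult_distrib flip: power_mult)
  qed
  have \<beta>: "\<beta> sums (b0 * F (q\<^sup>2) + b1 * F q + b2 * F 1)"
  proof -
    have "(\<lambda>n. b0 * (c n * (q\<^sup>2 * x) ^ n) + b1 * (c n * (q * x) ^ n) + b2 * (c n * (1 * x) ^ n))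
        sums (b0 * F (q\<^sup>2) + b1 * F q + b2 * F 1)"
      by (intro sums_add sums_mult sums n0 n1 n2)
    then show ?thesis
      unfolding \<beta>_def
      by (rule sums_cong[THEN iffD1, rotated])
         (simp add: algebra_simps power_mult_distrib flip: power_mult)
  qed
  have "\<alpha> 0 = 0"
    using A[of "1 / q"] q0 by (simp add: \<alpha>_def)
  \<comment> \<open>Terms of equal degree in \<open>x\<close> cancel: \<open>A\<close> factors the
    left side, the coefficient recursion lowers the index, and \<open>B\<close> recognizes the
    result.\<close>
  have "\<alpha> (Suc n) = - x * \<beta> n" for n
  proof -
    have "\<alpha> (Suc n) = \<mu> * (qphi_coeff as bs q (Suc n)
        * ((1 - q * q ^ n) * prod_list (map (\<lambda>b. 1 - b * q ^ n) bs))) * \<kappa> ^ Suc n * x ^ Suc n"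
      using A[of "q ^ n"] by (simp add: \<alpha>_def c_def)
    also have "\<dots> = - x * ((- \<mu> * \<kappa> * (prod_list (map (\<lambda>a. 1 - a * q ^ n) as) * (- (q ^ n)) ^ d))
        * c n * x ^ n)"
      by (subst qphi_coeff_Suc[OF q(2) len b]) (auto simp: c_def)
    also have "\<dots> = - x * \<beta> n"
      unfolding \<beta>_def B ..
    finally show ?thesis .
  qed
  then have "(\<lambda>n. \<alpha> (Suc n)) sums (- x * (b0 * F (q\<^sup>2) + b1 * F q + b2 * F 1))"
    using sums_mult[OF \<beta>, of "- x"] by simp
  from sums_Suc[OF this] \<open>\<alpha> 0 = 0\<close>
  have "\<alpha> sums (- x * (b0 * F (q\<^sup>2) + b1 * F q + b2 * F 1))" by simp
  from sums_unique2[OF \<alpha> this]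
  have "(a0 * F (q\<^sup>2) + a1 * F q + a2 * F 1) + x * (b0 * F (q\<^sup>2) + b1 * F q + b2 * F 1) = 0"
    by simp
  moreover have "qeq_lhs q (QEq a0 b0 a1 b1 a2 b2) (\<lambda>t. qphi as bs q (\<kappa> * exp t)) t
      = (a0 * F (q\<^sup>2) + a1 * F q + a2 * F 1) + x * (b0 * F (q\<^sup>2) + b1 * F q + b2 * F 1)"
    using F[of 1] by (simp add: e1 e2 F flip: x_def) (simp add: algebra_simps)
  ultimately show "qeq_lhs q (QEq a0 b0 a1 b1 a2 b2) (\<lambda>t. qphi as bs q (\<kappa> * exp t)) t = 0"
    by simp
qed

section \<open>The transformations\<close>

text \<open>With \<open>\<gamma> * Ln q = - g\<close>, each shift by \<open>Ln q\<close> divides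
  \<open>exp (\<gamma> * t)\<close> by \<open>p\<close>, and the powers of \<open>p\<close> in the
  new coefficients compensate. The new left side is \<open>l * exp (\<gamma> * t)\<close> times the
  old one, and this factor never vanishes.\<close>

lemma transforms_power:
  assumes "\<gamma> = - g / Ln q" "Ln q \<noteq> 0" "p = exp g" "l \<noteq> 0"
  shows "transforms_on q S (\<lambda>u t. exp (\<gamma> * t) * u t) (QEq a0 b0 a1 b1 a2 b2)
    (QEq (l * p\<^sup>2 * a0) (l * p\<^sup>2 * b0) (l * p * a1) (l * p * b1) (l * a2) (l * b2))"
proof -
  have \<gamma>: "\<gamma> * Ln q = - g"
    using assms by simp
  have g: "\<gamma> * (t + Ln q) = \<gamma> * t - g" "\<gamma> * (t + 2 * Ln q) = \<gamma> * t - 2 * g" for t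
    using \<gamma> by (simp_all add: distrib_left mult.left_commute[of \<gamma> 2])
  have "qeq_lhs q (QEq (l * p\<^sup>2 * a0) (l * p\<^sup>2 * b0) (l * p * a1) (l * p * b1) (l * a2) (l * b2))
      (\<lambda>t. exp (\<gamma> * t) * u t) t = l * exp (\<gamma> * t) * qeq_lhs q (QEq a0 b0 a1 b1 a2 b2) u t" for u t
    using assms(3) unfolding qeq_lhs.simps g exp_diff exp_double
    by (simp add: field_simps)
  then show ?thesis
    using \<open>l \<noteq> 0\<close> by (simp add: transforms_on_def solves_on_def del: qeq_lhs.simps)
qed

lemma transforms_scale:
  "transforms_on q UNIV (\<lambda>u t. u (t + \<kappa>)) (QEq a0 b0 a1 b1 a2 b2)
    (QEq a0 (exp \<kappa> * b0) a1 (exp \<kappa> * b1) a2 (exp \<kappa> * b2))"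
proof -
  have "qeq_lhs q (QEq a0 (exp \<kappa> * b0) a1 (exp \<kappa> * b1) a2 (exp \<kappa> * b2)) (\<lambda>t. u (t + \<kappa>)) t
      = qeq_lhs q (QEq a0 b0 a1 b1 a2 b2) u (t + \<kappa>)" for u t
    by (simp add: exp_add add_ac mult_ac)
  then show ?thesis
    unfolding transforms_on_def solves_on_def by (metis UNIV_I diff_add_cancel)
qed

text \<open>Inversion reverses the order of the three points. The old equation is therefore taken at
  \<open>- t - 2 * Ln q\<close>, and multiplication by \<open>q\<^sup>2 * exp t\<close> clears the
  negative power of \<open>x\<close>; this accounts for the factors
  \<open>q\<^sup>2\<close>.\<close>

lemma transforms_invert:
  assumes "q \<noteq> 0"
  shows "transforms_on q UNIV (\<lambda>u t. u (- t)) (QEq a0 b0 a1 b1 a2 b2)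
    (QEq b2 (a2 * q\<^sup>2) b1 (a1 * q\<^sup>2) b0 (a0 * q\<^sup>2))"
proof -
  have eq: "qeq_lhs q (QEq b2 (a2 * q\<^sup>2) b1 (a1 * q\<^sup>2) b0 (a0 * q\<^sup>2)) (\<lambda>t. u (- t)) t
      = q\<^sup>2 * exp t * qeq_lhs q (QEq a0 b0 a1 b1 a2 b2) u (- t - 2 * Ln q)" for u t
  proof -
    have shift: "- t - 2 * Ln q + 2 * Ln q = - t" "- t - 2 * Ln q + Ln q = - (t + Ln q)"
      "- t - 2 * Ln q = - (t + 2 * Ln q)"
      by simp_all
    have coeff: "b + a * q\<^sup>2 * exp t = q\<^sup>2 * exp t * (a + b * exp (- (t + 2 * Ln q)))" for a b
      unfolding exp_minus exp_add exp_double using assms by (simp add: field_simps)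
    show ?thesis
      unfolding qeq_lhs.simps shift(1,2) unfolding shift(3) coeff
      by (simp only: distrib_left distrib_right mult.assoc add_ac)
  qed
  have "(\<forall>t. P (- t - c)) \<longleftrightarrow> (\<forall>t. P t)" for P and c :: complex
    by (metis add.inverse_inverse diff_add_cancel minus_diff_eq uminus_add_conv_diff)
  from this[of "\<lambda>t. qeq_lhs q (QEq a0 b0 a1 b1 a2 b2) _ t = 0"] show ?thesis
    unfolding transforms_on_def solves_on_def eq using assms by (simp del: qeq_lhs.simps)
qed

section \<open>Functional equations of the infinite product and of theta, and the gauge
  transformation\<close>

lemma qpoch_inf_rec:
  assumes "norm q < 1"
  shows "qpoch_inf a q = (1 - a) * qpoch_inf (a * q) q"
proof -
  have conv: "convergent_prod (\<lambda>k. 1 - a * q ^ k)" for a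
  proof -
    have "summable (\<lambda>k. norm ((1 - a * q ^ k) - 1))"
      using assms by (simp add: norm_mult norm_power summable_mult summable_geometric)
    then show ?thesis
      by (intro abs_convergent_prod_imp_convergent_prod summable_imp_abs_convergent_prod)
  qed
  have "(\<lambda>n. \<Prod>k\<le>n. 1 - a * q ^ k) \<longlonglongrightarrow> qpoch_inf a q"
    unfolding qpoch_inf_def by (rule convergent_prod_LIMSEQ[OF conv])
  then have "(\<lambda>n. \<Prod>k\<le>Suc n. 1 - a * q ^ k) \<longlonglongrightarrow> qpoch_inf a q"
    by (rule LIMSEQ_Suc)
  moreover have "(\<lambda>n. (1 - a) * (\<Prod>k\<le>n. 1 - (a * q) * q ^ k)) \<longlonglongrightarrow> (1 - a) * qpoch_inf (a * q) q"
    unfolding qpoch_inf_def by (intro tendsto_mult tendsto_const convergent_prod_LIMSEQ[OF conv])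
  moreover have "(\<Prod>k\<le>Suc n. 1 - a * q ^ k) = (1 - a) * (\<Prod>k\<le>n. 1 - (a * q) * q ^ k)" for n
    by (subst prod.atMost_Suc_shift) (simp add: mult_ac)
  ultimately show ?thesis
    by (metis (no_types, lifting) LIMSEQ_unique ext)
qed

text \<open>Shift the summation index by one: the exponent \<open>n * (n - 1) div 2\<close> grows by
  \<open>n\<close>, which is absorbed into \<open>(q * x) powi n\<close>. Reindexing and scaling are
  unconditional laws of \<open>infsum\<close>.\<close>

lemma qtheta_rec:
  assumes "q \<noteq> 0" "x \<noteq> 0"
  shows "qtheta q x = x * qtheta q (q * x)"
proof -
  let ?f = "\<lambda>n::int. q powi (n * (n - 1) div 2) * x powi n"
  have "qtheta q x = infsum ?f (range (\<lambda>n. n + 1))"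
    unfolding qtheta_def by (rule arg_cong[where f = "infsum ?f"]) (metis surj_plus_right)
  also have "\<dots> = infsum (?f \<circ> (\<lambda>n. n + 1)) UNIV"
    by (rule infsum_reindex) simp
  also have "?f \<circ> (\<lambda>n. n + 1) = (\<lambda>n. x * (q powi (n * (n - 1) div 2) * (q * x) powi n))"
  proof
    fix n :: int
    have "(n + 1) * (n + 1 - 1) = n * (n - 1) + n * 2" by (simp add: algebra_simps)
    then have "(n + 1) * (n + 1 - 1) div 2 = n * (n - 1) div 2 + n" by simp
    then show "(?f \<circ> (\<lambda>n. n + 1)) n = x * (q powi (n * (n - 1) div 2) * (q * x) powi n)"
      using assms by (simp add: power_int_add power_int_mult_distrib del: add_diff_cancel_right')
  qed
  also have "infsum \<dots> UNIV = x * qtheta q (q * x)"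
    unfolding qtheta_def by (rule infsum_cmult_right')
  finally show ?thesis .
qed


text \<open>The middle coefficient stays fixed if \<open>h (t + Ln q)\<close> factors out of the new
  left side; the two assumptions say that the outer terms then factor as well. On the regular set
  this common factor is nonzero.\<close>

lemma transforms_gauge:
  assumes "\<And>t. h t \<noteq> 0 \<Longrightarrow> h (t + Ln q) \<noteq> 0 \<Longrightarrow> (a2' + b2' * exp t) * h t = (a2 + b2 * exp t) * h (t + Ln q)"
    and "\<And>t. h (t + Ln q) \<noteq> 0 \<Longrightarrow> h (t + 2 * Ln q) \<noteq> 0 \<Longrightarrow>
      (a0' + b0' * exp t) * h (t + 2 * Ln q) = (a0 + b0 * exp t) * h (t + Ln q)"
  shows "transforms_on q (regular_set q h) (\<lambda>u t. h t * u t) (QEq a0 b0 a1 b1 a2 b2)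
    (QEq a0' b0' a1 b1 a2' b2')"
  unfolding transforms_on_def solves_on_def
proof (intro allI ball_cong refl)
  fix u t assume t: "t \<in> regular_set q h"
  have h: "h (t + of_int k * Ln q) \<noteq> 0" for k
    using t by (simp add: regular_set_def)
  have nz: "h t \<noteq> 0" "h (t + Ln q) \<noteq> 0" "h (t + 2 * Ln q) \<noteq> 0"
    using h[of 0] h[of 1] h[of 2] by simp_all
  have "qeq_lhs q (QEq a0' b0' a1 b1 a2' b2') (\<lambda>t. h t * u t) t
      = ((a0' + b0' * exp t) * h (t + 2 * Ln q)) * u (t + 2 * Ln q)
        + (a1 + b1 * exp t) * h (t + Ln q) * u (t + Ln q)
        + ((a2' + b2' * exp t) * h t) * u t"
    by (simp add: mult_ac)
  also have "\<dots> = h (t + Ln q) * qeq_lhs q (QEq a0 b0 a1 b1 a2 b2) u t"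
    unfolding assms(1)[OF nz(1,2)] assms(2)[OF nz(2,3)] by (simp add: algebra_simps)
  finally show "qeq_lhs q (QEq a0 b0 a1 b1 a2 b2) u t = 0 \<longleftrightarrow>
      qeq_lhs q (QEq a0' b0' a1 b1 a2' b2') (\<lambda>t. h t * u t) t = 0"
    using nz by simp
qed

section \<open>Reductions\<close>

context
  fixes q :: complex
  assumes q: "0 < norm q" "norm q < 1"
begin

lemma q_nonzero: "q \<noteq> 0"
  using q by auto

lemma Ln_q_nonzero: "Ln q \<noteq> 0"
proof
  assume "Ln q = 0"
  then have "q = 1" using exp_Ln[OF q_nonzero] by simp
  with q show False by simp
qed

lemma exp_shift: "exp (t + Ln q) = q * exp t" "exp (t + 2 * Ln q) = q\<^sup>2 * exp t"
  using q_nonzero by (simp_all add: exp_add exp_double)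

section \<open>Reduction steps in terms of coefficients\<close>

lemma reduces_trans: "reduces q E F \<Longrightarrow> reduces q F G \<Longrightarrow> reduces q E G"
  unfolding reduces_def by (rule rtranclp_trans)

text \<open>Combines \<open>x \<rightarrow> k x\<close> with a power step: \<open>p\<close> comes
  from the exponent \<open>- Ln p / Ln q\<close>, and \<open>l\<close> is the free common factor.
  The target coefficients enter through equations, so that each normal form only has to supply
  \<open>l\<close>, \<open>p\<close> and \<open>k\<close>.\<close>

lemma reduces_rescale:
  assumes nz: "l \<noteq> 0" "p \<noteq> 0" "k \<noteq> 0"
    and eq: "a0' = l * p\<^sup>2 * a0" "b0' = l * p\<^sup>2 * (k * b0)" "a1' = l * p * a1"
      "b1' = l * p * (k * b1)" "a2' = l * a2" "b2' = l * (k * b2)"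
  shows "reduces q (QEq a0 b0 a1 b1 a2 b2) (QEq a0' b0' a1' b1' a2' b2')"
proof -
  have "qstep q (QEq a0 b0 a1 b1 a2 b2) (QEq a0 (k * b0) a1 (k * b1) a2 (k * b2))"
    using transforms_scale[of q "Ln k"] nz by (intro qstep.scale) simp
  moreover have "qstep q \<dots> (QEq a0' b0' a1' b1' a2' b2')"
    unfolding eq using nz Ln_q_nonzero
    by (intro qstep.power[OF transforms_power[where g = "Ln p", OF refl]]) simp_all
  ultimately show ?thesis
    unfolding reduces_def by (meson rtranclp.rtrancl_into_rtrancl r_into_rtranclp)
qed

lemma reduces_invert:
  "reduces q (QEq a0 b0 a1 b1 a2 b2) (QEq b2 (a2 * q\<^sup>2) b1 (a1 * q\<^sup>2) b0 (a0 * q\<^sup>2))"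
  unfolding reduces_def
  by (intro r_into_rtranclp qstep.invert transforms_invert q_nonzero)

text \<open>The functional equations of both products give a first-order relation for
  \<open>h\<close> that carries the linear factor of one outer coefficient over to the other. This
  serves to make \<open>b2\<close> nonzero when only \<open>b0\<close> is.\<close>

lemma reduces_gauge:
  assumes "a0 \<noteq> 0" "a2 \<noteq> 0"
  shows "reduces q (QEq a0 b0 a1 b1 a2 b2)
    (QEq a0 (a0 * b2 * q / a2) a1 b1 a2 (a2 * b0 / (a0 * q)))"
proof -
  define h where "h = gauge_factor q 1 1 (QEq a0 b0 a1 b1 a2 b2)"
  define N where "N t = qpoch_inf (- b2 / a2 * exp t) q" for t
  define D where "D t = qpoch_inf (- b0 / (a0 * q) * exp t) q" for t
  have h: "h t = N t / D t" for t
    using assms by (simp add: h_def N_def D_def)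
  have N: "N t = (1 + b2 / a2 * exp t) * N (t + Ln q)" for t
    unfolding N_def by (subst qpoch_inf_rec[OF q(2)]) (simp add: exp_shift mult_ac)
  have D: "D t = (1 + b0 / (a0 * q) * exp t) * D (t + Ln q)" for t
    unfolding D_def by (subst qpoch_inf_rec[OF q(2)]) (simp add: exp_shift mult_ac)
  \<comment> \<open>A nonzero value of the quotient rules out division by zero: \<open>D t\<close>
    is nonzero, hence by its recursion so are its linear factor and
    \<open>D (t + Ln q)\<close>.\<close>
  have rec: "(1 + b0 / (a0 * q) * exp t) * h t = (1 + b2 / a2 * exp t) * h (t + Ln q)"
    if "h t \<noteq> 0" for t
    using that N[of t] D[of t] by (auto simp: h)
  show ?thesis
    unfolding reduces_def
  proof (intro r_into_rtranclp qstep.gauge[of 1 1, OF _ _ h_def] transforms_gauge)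
    fix t assume "h t \<noteq> 0"
    from rec[OF this] show "(a2 + a2 * b0 / (a0 * q) * exp t) * h t = (a2 + b2 * exp t) * h (t + Ln q)"
      using assms q_nonzero by (simp add: field_simps)
  next
    \<comment> \<open>The relation is used at \<open>t + Ln q\<close>, where \<open>exp t\<close>
      becomes \<open>q * exp t\<close>; this cancels the \<open>q\<close> in
      \<open>b0 / (a0 * q)\<close>.\<close>
    fix t assume "h (t + Ln q) \<noteq> 0"
    from rec[OF this]
    show "(a0 + a0 * b2 * q / a2 * exp t) * h (t + 2 * Ln q) = (a0 + b0 * exp t) * h (t + Ln q)"
      using assms q_nonzero by (simp add: exp_shift add.assoc flip: mult_2) (simp add: field_simps)
  qed simp_all
qed

lemma reduces_theta_gauge:
  assumes "a0 \<noteq> 0"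
  shows "reduces q (QEq a0 0 a1 b1 0 b2) (QEq 0 (a0 * q) a1 b1 b2 0)"
proof -
  define h where "h = gauge_factor q 1 1 (QEq a0 0 a1 b1 0 b2)"
  \<comment> \<open>Here \<open>a2 = 0\<close> selects theta in the numerator, while
    \<open>b0 = 0\<close> and \<open>a0 \<noteq> 0\<close> make the denominator the empty-looking
    product \<open>(0; q)\<close> with value 1.\<close>
  have h: "h t = qtheta q (exp t)" for t
    using assms by (simp add: h_def qpoch_inf_def)
  have rec: "h t = exp t * h (t + Ln q)" for t
    unfolding h by (subst qtheta_rec[OF q_nonzero]) (simp_all add: exp_shift)
  show ?thesis
    unfolding reduces_def
  proof (intro r_into_rtranclp qstep.gauge[of 1 1, OF _ _ h_def] transforms_gauge)
    fix t
    show "(b2 + 0 * exp t) * h t = (0 + b2 * exp t) * h (t + Ln q)"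
      using rec[of t] by simp
    show "(0 + a0 * q * exp t) * h (t + 2 * Ln q) = (a0 + 0 * exp t) * h (t + Ln q)"
      using rec[of "t + Ln q"] by (simp add: exp_shift add.assoc flip: mult_2)
  qed simp_all
qed

section \<open>Exponents and parameters as roots of quadratics\<close>

lemma quadratic_root:
  fixes a b c :: complex
  assumes "a \<noteq> 0"
  obtains p where "a * p\<^sup>2 + b * p + c = 0"
proof
  let ?d = "csqrt (b\<^sup>2 - 4 * a * c)"
  have "a * ((- b + ?d) / (2 * a))\<^sup>2 + b * ((- b + ?d) / (2 * a)) + c
      = (?d\<^sup>2 - (b\<^sup>2 - 4 * a * c)) / (4 * a)"
    using assms by (simp add: power_divide del: power2_csqrt)
      (simp add: field_simps power2_eq_square)
  then show "a * ((- b + ?d) / (2 * a))\<^sup>2 + b * ((- b + ?d) / (2 * a)) + c = 0"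
    by simp
qed

lemma sum_product:
  fixes S P :: complex
  obtains a b where "a + b = S" "a * b = P"
proof -
  obtain a where "1 * a\<^sup>2 + (- S) * a + P = 0" by (rule quadratic_root[of 1 "- S" P]) auto
  then have "a * (S - a) = P" by (simp add: algebra_simps power2_eq_square)
  then show thesis using that[of a "S - a"] by simp
qed

text \<open>Take numbers \<open>z\<close>, \<open>z'\<close> with sum \<open>w\<close> and product
  1; then \<open>z' = 1 / z\<close>, and \<nu> is the logarithm of \<open>z\<close> to base
  \<open>q\<close>.\<close>

lemma powr_sum:
  obtains \<nu> where "q powr \<nu> + q powr (- \<nu>) = w"
proof -
  obtain z z' where z: "z + z' = w" "z * z' = 1" by (rule sum_product)
  then have "z \<noteq> 0" by auto
  then have "q powr (Ln z / Ln q) = z"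
    using q_nonzero Ln_q_nonzero by (simp add: powr_def)
  moreover from this have "q powr (- (Ln z / Ln q)) = z'"
    using z \<open>z \<noteq> 0\<close> by (simp add: powr_minus field_simps)
  ultimately show thesis using z that by metis
qed

section \<open>Normal forms of the list, by rescaling\<close>

lemma reduces_heine:
  assumes "a0 \<noteq> 0" "a2 \<noteq> 0" "b2 \<noteq> 0"
  shows "\<exists>a b c. reduces q (QEq a0 b0 a1 b1 a2 b2) (heine_eq q a b c)"
proof -
  obtain p where p: "a0 * p\<^sup>2 + a1 * p + a2 = 0" by (rule quadratic_root[OF \<open>a0 \<noteq> 0\<close>])
  then have "p \<noteq> 0" using assms by auto
  \<comment> \<open>By Vieta, \<open>a\<close> and \<open>b\<close> are read off from the linear
    parts of the rescaled coefficients.\<close>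
  obtain a b where ab: "a + b = - (p * b1 / b2)" "a * b = p\<^sup>2 * b0 / b2" by (rule sum_product)
  \<comment> \<open>Because \<open>p\<close> is a root, the constant parts sum to zero after
    rescaling. So the middle one is \<open>- (c + q)\<close> once the outer ones are
    \<open>c\<close> and \<open>q\<close>.\<close>
  have "q / a2 * p * a1 = q / a2 * (a0 * p\<^sup>2 + a1 * p + a2) - (q / a2 * p\<^sup>2 * a0 + q)"
    using assms by (simp add: field_simps)
  then have "- (q / a2 * p\<^sup>2 * a0 + q) = q / a2 * p * a1"
    unfolding p by simp
  then have "reduces q (QEq a0 b0 a1 b1 a2 b2) (heine_eq q a b (q / a2 * p\<^sup>2 * a0))"
    unfolding heine_eq_def ab using assms \<open>p \<noteq> 0\<close> q_nonzero
    by (intro reduces_rescale[of "q / a2" p "- a2 / b2"]) simp_all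
  then show ?thesis by blast
qed

lemma reduces_phi11:
  assumes "a0 \<noteq> 0" "a2 \<noteq> 0" "b1 \<noteq> 0"
  shows "\<exists>a c. reduces q (QEq a0 b0 a1 b1 a2 0) (phi11_eq q a c)"
proof -
  obtain p where p: "a0 * p\<^sup>2 + a1 * p + a2 = 0" by (rule quadratic_root[OF \<open>a0 \<noteq> 0\<close>])
  then have "p \<noteq> 0" using assms by auto
  have "q / a2 * p * a1 = q / a2 * (a0 * p\<^sup>2 + a1 * p + a2) - (q / a2 * p\<^sup>2 * a0 + q)"
    using assms by (simp add: field_simps)
  then have "- (q / a2 * p\<^sup>2 * a0 + q) = q / a2 * p * a1"
    unfolding p by simp
  then have "reduces q (QEq a0 b0 a1 b1 a2 0) (phi11_eq q (- (p * b0 / b1)) (q / a2 * p\<^sup>2 * a0))"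
    unfolding phi11_eq_def using assms \<open>p \<noteq> 0\<close> q_nonzero
    \<comment> \<open>\<open>l\<close> makes the last coefficient \<open>q\<close>, and
      \<open>k\<close> makes the linear part of the middle one \<open>q\<close>; the parameter
      \<open>a\<close> is what remains of \<open>b0\<close>.\<close>
    by (intro reduces_rescale[of "q / a2" p "a2 / (p * b1)"])
       (simp_all add: power2_eq_square)
  then show ?thesis by blast
qed

text \<open>Here \<open>p\<^sup>2 = a2 / a0\<close> makes both outer constants 1 after division by
  \<open>a2\<close>; the middle constant then determines \<nu>, and \<open>k\<close> adjusts the
  remaining linear part.\<close>

lemma reduces_bessel_E1:
  assumes "a0 \<noteq> 0" "a2 \<noteq> 0" "b2 \<noteq> 0"
  shows "\<exists>\<nu>. reduces q (QEq a0 0 a1 0 a2 b2) (bessel_E1_eq q \<nu>)"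
proof -
  define p where "p = csqrt (a2 / a0)"
  have p: "p\<^sup>2 = a2 / a0" and "p \<noteq> 0" using assms by (simp_all add: p_def)
  obtain \<nu> where \<nu>: "q powr \<nu> + q powr (- \<nu>) = - (p * a1 / a2)" by (rule powr_sum)
  have "reduces q (QEq a0 0 a1 0 a2 b2) (bessel_E1_eq q \<nu>)"
    unfolding bessel_E1_eq_def \<nu> using assms \<open>p \<noteq> 0\<close>
    by (intro reduces_rescale[of "1 / a2" p "a2 / (4 * b2)"]) (simp_all add: p)
  then show ?thesis by blast
qed

lemma reduces_bessel_E3:
  assumes "a0 \<noteq> 0" "a2 \<noteq> 0" "b1 \<noteq> 0"
  shows "\<exists>\<nu>. reduces q (QEq a0 0 a1 b1 a2 0) (bessel_E3_eq q \<nu>)"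
proof -
  define p where "p = csqrt (a2 / a0)"
  have p: "p\<^sup>2 = a2 / a0" and "p \<noteq> 0" using assms by (simp_all add: p_def)
  obtain \<nu> where \<nu>: "q powr \<nu> + q powr (- \<nu>) = - (p * a1 / a2)" by (rule powr_sum)
  have "reduces q (QEq a0 0 a1 b1 a2 0) (bessel_E3_eq q \<nu>)"
    unfolding bessel_E3_eq_def \<nu> using assms \<open>p \<noteq> 0\<close> q_nonzero
    by (intro reduces_rescale[of "1 / a2" p "a2 * q powr (2 - \<nu>) / (p * b1)"]) (simp_all add: p)
  then show ?thesis by blast
qed

lemma reduces_hermite_weber:
  assumes "a1 \<noteq> 0" "a2 \<noteq> 0" "b1 \<noteq> 0"
  shows "\<exists>a. reduces q (QEq 0 b0 a1 b1 a2 0) (hermite_weber_eq a)"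
proof -
  \<comment> \<open>With \<open>a0 = 0\<close> the equation for the exponent is linear, and this is
    its root.\<close>
  define p where "p = - a2 / a1"
  define k where "k = - a1 / b1"
  have "reduces q (QEq 0 b0 a1 b1 a2 0) (hermite_weber_eq (- 1 / a2 * p\<^sup>2 * (k * b0)))"
    unfolding hermite_weber_eq_def using assms
    by (intro reduces_rescale[of "- 1 / a2" p k]) (simp_all add: p_def k_def)
  then show ?thesis by blast
qed

lemma reduces_airy:
  assumes "a0 \<noteq> 0" "a2 \<noteq> 0" "b1 \<noteq> 0"
  shows "reduces q (QEq a0 0 0 b1 a2 0) airy_eq"
proof -
  define p where "p = csqrt (- a2 / a0)"
  have p: "p\<^sup>2 = - a2 / a0" and "p \<noteq> 0" using assms by (simp_all add: p_def)
  then show ?thesis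
    unfolding airy_eq_def using assms
    by (intro reduces_rescale[of "- 1 / a2" p "- a2 / (p * b1)"]) (simp_all add: p)
qed

lemma reduces_ramanujan:
  assumes "a1 \<noteq> 0" "a2 \<noteq> 0" "b0 \<noteq> 0"
  shows "reduces q (QEq 0 b0 a1 0 a2 0) (ramanujan_eq q)"
  unfolding ramanujan_eq_def using assms q_nonzero
  by (intro reduces_rescale[of "1 / a2" "- a2 / a1" "q * a1\<^sup>2 / (a2 * b0)"])
     (simp_all add: power2_eq_square)

section \<open>Exhaustion of the zero patterns\<close>

definition reducible :: "qeq \<Rightarrow> bool" where
  "reducible E \<longleftrightarrow>
    (\<exists>a b c. reduces q E (heine_eq q a b c)) \<or>
    (\<exists>a c. reduces q E (phi11_eq q a c)) \<or>
    (\<exists>\<nu>. reduces q E (bessel_E1_eq q \<nu>)) \<or>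
    (\<exists>\<nu>. reduces q E (bessel_E3_eq q \<nu>)) \<or>
    (\<exists>a. reduces q E (hermite_weber_eq a)) \<or>
    reduces q E airy_eq \<or>
    reduces q E (ramanujan_eq q)"

lemma reducible_step: "reduces q E F \<Longrightarrow> reducible F \<Longrightarrow> reducible E"
  unfolding reducible_def by (meson reduces_trans)

lemma reducible_a0_a2:
  assumes "a0 \<noteq> 0" "a2 \<noteq> 0" "b0 \<noteq> 0 \<or> b1 \<noteq> 0 \<or> b2 \<noteq> 0"
  shows "reducible (QEq a0 b0 a1 b1 a2 b2)"
proof (cases "b2 = 0")
  case False
  then show ?thesis using reduces_heine assms unfolding reducible_def by blast
next
  case b2: True
  show ?thesis
  proof (cases "b1 = 0")
    case False
    then show ?thesis using reduces_phi11 assms b2 unfolding reducible_def by blast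
  next
    case True
    with assms b2 have "b0 \<noteq> 0" by simp
    \<comment> \<open>This is the new \<open>b2\<close> after the gauge step, so the Heine case
      applies.\<close>
    then have "a2 * b0 / (a0 * q) \<noteq> 0" using assms q_nonzero by simp
    from reduces_heine[OF assms(1,2) this] show ?thesis
      unfolding reducible_def by (blast intro: reduces_trans[OF reduces_gauge[OF assms(1,2)]])
  qed
qed

lemma reducible_b0_a2:
  assumes "a2 \<noteq> 0" "b0 \<noteq> 0" "a1 \<noteq> 0 \<or> b1 \<noteq> 0"
  shows "reducible (QEq 0 b0 a1 b1 a2 0)"
proof (cases "b1 = 0")
  case True
  then show ?thesis using reduces_ramanujan assms unfolding reducible_def by blast
next
  case b1: False
  show ?thesis
  proof (cases "a1 = 0")
    case False
    then show ?thesis using reduces_hermite_weber assms b1 unfolding reducible_def by blast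
  next
    case True
    \<comment> \<open>Inversion keeps the pattern of the outer coefficients but moves
      \<open>b1\<close> into the place of \<open>a1\<close>, which is the Ramanujan pattern.\<close>
    have "reduces q (QEq 0 (a2 * q\<^sup>2) b1 0 b0 0) (ramanujan_eq q)"
      using assms b1 q_nonzero by (intro reduces_ramanujan) auto
    then show ?thesis
      using True reducible_step[OF reduces_invert, of 0 a2 b1 a1 b0 0] by (simp add: reducible_def)
  qed
qed

lemma reducible:
  assumes "second_order E" "nondegenerate E"
  shows "reducible E"
proof (cases E)
  case (QEq a0 b0 a1 b1 a2 b2)
  note E = assms[unfolded QEq, simplified]
  \<comment> \<open>Second order provides a nonzero entry in each outer column. Either both can be
    chosen in the same row, or the nonzero entries lie on a diagonal and the other two vanish.
    Nondegeneracy then supplies the entry that each case still lacks.\<close>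
  consider "a0 \<noteq> 0" "a2 \<noteq> 0" | "b0 \<noteq> 0" "b2 \<noteq> 0" | "a0 \<noteq> 0" "a2 = 0" "b0 = 0" "b2 \<noteq> 0"
    | "a0 = 0" "a2 \<noteq> 0" "b0 \<noteq> 0" "b2 = 0"
    using E by blast
  then show ?thesis
  proof cases
    case 1
    then show ?thesis using E unfolding QEq by (intro reducible_a0_a2) auto
  next
    case 2
    then show ?thesis using E q_nonzero unfolding QEq
      by (intro reducible_step[OF reduces_invert reducible_a0_a2]) auto
  next
    case 3
    have "reducible (QEq 0 (a0 * q) a1 b1 b2 0)"
      using E 3 q_nonzero by (intro reducible_b0_a2) auto
    with 3 show ?thesis
      unfolding QEq using reducible_step[OF reduces_theta_gauge] by blast
  next
    case 4
    then show ?thesis using E unfolding QEq by (auto intro: reducible_b0_a2)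
  qed
qed

section \<open>Solutions\<close>

lemma solves_heine:
  assumes "\<And>k. c * q ^ k \<noteq> 1"
  shows "solves_on q {t. norm (exp t) < 1} (heine_eq q a b c) (\<lambda>t. qphi [a, b] [c] q (exp t))"
proof -
  have "solves_on q {t. norm (exp t) < 1} (heine_eq q a b c) (\<lambda>t. qphi [a, b] [c] q (1 * exp t))"
    unfolding heine_eq_def
    \<comment> \<open>The constant parts give \<open>q (1 - q y) (1 - c y)\<close> and the linear
      parts \<open>- q (1 - a y) (1 - b y)\<close>.\<close>
    by (rule qphi_solves[where d = 0 and \<mu> = q])
       (use q assms in simp_all, simp_all add: algebra_simps power2_eq_square)
  then show ?thesis by simp
qed

lemma solves_phi11:
  assumes "\<And>k. c * q ^ k \<noteq> 1"
  shows "solves_on q UNIV (phi11_eq q a c) (\<lambda>t. qphi [a] [c] q (exp t))"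
proof -
  have "solves_on q UNIV (phi11_eq q a c) (\<lambda>t. qphi [a] [c] q (1 * exp t))"
    unfolding phi11_eq_def
    by (rule qphi_solves[where d = 1 and \<mu> = q])
       (use q assms in simp_all, simp_all add: algebra_simps power2_eq_square)
  then show ?thesis by simp
qed

text \<open>Passes from the equation of a power series to that of \<open>x\<close> to the \<nu>
  times it, by a power step with \<open>p\<close> equal to \<open>q powr (- \<nu>)\<close>.\<close>

lemma solves_on_power:
  assumes "solves_on q S (QEq a0 b0 a1 b1 a2 b2) u"
    and "a0 = (q powr \<nu>)\<^sup>2 * a0'" "b0 = (q powr \<nu>)\<^sup>2 * b0'" "a1 = q powr \<nu> * a1'" "b1 = q powr \<nu> * b1'"
  shows "solves_on q S (QEq a0' b0' a1' b1' a2 b2) (\<lambda>t. exp (\<nu> * t) * u t)"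
proof -
  have p: "exp (- \<nu> * Ln q) * q powr \<nu> = 1"
    using q_nonzero by (simp add: powr_def flip: exp_add)
  have "1 * (exp (- \<nu> * Ln q))\<^sup>2 * a0 = a0'" "1 * (exp (- \<nu> * Ln q))\<^sup>2 * b0 = b0'"
    "1 * exp (- \<nu> * Ln q) * a1 = a1'" "1 * exp (- \<nu> * Ln q) * b1 = b1'" "1 * a2 = a2" "1 * b2 = b2"
    unfolding assms(2-5) mult_1 mult.assoc[symmetric] power_mult_distrib[symmetric] p by simp_all
  moreover have "transforms_on q S (\<lambda>u t. exp (\<nu> * t) * u t) (QEq a0 b0 a1 b1 a2 b2)
      (QEq (1 * (exp (- \<nu> * Ln q))\<^sup>2 * a0) (1 * (exp (- \<nu> * Ln q))\<^sup>2 * b0)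
        (1 * exp (- \<nu> * Ln q) * a1) (1 * exp (- \<nu> * Ln q) * b1) (1 * a2) (1 * b2))"
    by (rule transforms_power[where g = "- \<nu> * Ln q"]) (use Ln_q_nonzero in simp_all)
  ultimately show ?thesis
    using assms(1) by (simp only: transforms_on_def)
qed

lemma powr_identities:
  "q powr (2 * \<nu> + 1) = q * (q powr \<nu>)\<^sup>2" "q powr (- \<nu>) * q powr \<nu> = 1"
  "q powr (2 - \<nu>) * q powr \<nu> = q\<^sup>2"
proof -
  have "(2 * \<nu> + 1) * Ln q = Ln q + (\<nu> * Ln q + \<nu> * Ln q)" "(2 - \<nu>) * Ln q = Ln q + Ln q - \<nu> * Ln q"
    by (simp_all add: algebra_simps)
  then show "q powr (2 * \<nu> + 1) = q * (q powr \<nu>)\<^sup>2" "q powr (- \<nu>) * q powr \<nu> = 1"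
    "q powr (2 - \<nu>) * q powr \<nu> = q\<^sup>2"
    using q_nonzero by (simp_all add: powr_def exp_add exp_diff exp_minus exp_double power2_eq_square)
qed

lemma solves_bessel_E1:
  assumes "\<And>k. q powr (2 * \<nu> + 1) * q ^ k \<noteq> 1"
  shows "solves_on q {t. norm (exp t) < 4} (bessel_E1_eq q \<nu>) (bessel_E1 q \<nu>)"
proof -
  let ?Q = "q powr \<nu>"
  \<comment> \<open>Stripping the power of \<open>x\<close> turns the exponents into
    \<open>1\<close> and \<open>q powr (- 2 * \<nu>)\<close>: the constant parts give
    \<open>(1 - q y) (1 - q ?Q\<^sup>2 y)\<close>. The radius 4 comes from the argument
    \<open>- x / 4\<close>.\<close>
  have "solves_on q {t. norm (exp t) < 4} (QEq (?Q\<^sup>2) 0 (- (?Q\<^sup>2 + 1)) 0 1 (1 / 4))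
    (\<lambda>t. qphi [0, 0] [q powr (2 * \<nu> + 1)] q (- 1 / 4 * exp t))"
    by (rule qphi_solves[where d = 0 and \<mu> = 1])
       (use q assms in \<open>simp_all add: norm_mult\<close>, simp_all add: powr_identities(1), simp_all add: algebra_simps power2_eq_square)
  then have "solves_on q {t. norm (exp t) < 4} (bessel_E1_eq q \<nu>)
    (\<lambda>t. exp (\<nu> * t) * qphi [0, 0] [q powr (2 * \<nu> + 1)] q (- 1 / 4 * exp t))"
    unfolding bessel_E1_eq_def
    by (rule solves_on_power)
       (use powr_identities(2)[of \<nu>] in \<open>simp_all add: algebra_simps power2_eq_square\<close>)
  then show ?thesis
    by (simp add: bessel_E1_def[abs_def])
qed

lemma solves_bessel_E3:
  assumes "\<And>k. q powr (2 * \<nu> + 1) * q ^ k \<noteq> 1"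
  shows "solves_on q UNIV (bessel_E3_eq q \<nu>) (bessel_E3 q \<nu>)"
proof -
  let ?Q = "q powr \<nu>"
  have "solves_on q UNIV (QEq (?Q\<^sup>2) 0 (- (?Q\<^sup>2 + 1)) (q\<^sup>2) 1 0)
    (\<lambda>t. qphi [0] [q powr (2 * \<nu> + 1)] q (q\<^sup>2 * exp t))"
    by (rule qphi_solves[where d = 1 and \<mu> = 1])
       (use q assms in simp_all, simp_all add: powr_identities(1), simp_all add: algebra_simps power2_eq_square)
  then have "solves_on q UNIV (bessel_E3_eq q \<nu>)
    (\<lambda>t. exp (\<nu> * t) * qphi [0] [q powr (2 * \<nu> + 1)] q (q\<^sup>2 * exp t))"
    unfolding bessel_E3_eq_def
    by (rule solves_on_power)
       (use powr_identities(2,3)[of \<nu>] in \<open>simp_all add: algebra_simps power2_eq_square\<close>)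
  then show ?thesis
    by (simp add: bessel_E3_def[abs_def])
qed

lemma solves_hermite_weber:
  "solves_on q UNIV (hermite_weber_eq a) (\<lambda>t. qphi [a] [0] q (exp t))"
proof -
  have "solves_on q UNIV (hermite_weber_eq a) (\<lambda>t. qphi [a] [0] q (1 * exp t))"
    unfolding hermite_weber_eq_def
    by (rule qphi_solves[where d = 1 and \<mu> = "- 1"])
       (use q in \<open>simp_all add: algebra_simps power2_eq_square\<close>)
  then show ?thesis by simp
qed

lemma solves_airy: "solves_on q UNIV airy_eq (\<lambda>t. qphi [0] [- q] q (- exp t))"
proof -
  \<comment> \<open>The lower parameter \<open>- q\<close> is admissible because a power of
    \<open>q\<close> with positive exponent has modulus below 1.\<close>
  have "- q * q ^ k \<noteq> 1" for k
  proof
    assume "- q * q ^ k = 1"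
    then have "q ^ Suc k = - 1" by (simp add: minus_equation_iff[of _ 1])
    then have "norm (q ^ Suc k) = 1" by (simp only: norm_minus_cancel norm_one)
    moreover have "norm (q ^ Suc k) < 1"
      using q(2) by (simp add: norm_power power_less_one_iff del: power_Suc)
    ultimately show False by simp
  qed
  then have "solves_on q UNIV airy_eq (\<lambda>t. qphi [0] [- q] q (- 1 * exp t))"
    unfolding airy_eq_def
    by (intro qphi_solves[where d = 1 and \<mu> = "- 1"])
       (use q in \<open>simp_all add: algebra_simps power2_eq_square\<close>)
  then show ?thesis by simp
qed

lemma solves_ramanujan: "solves_on q UNIV (ramanujan_eq q) (\<lambda>t. qphi [] [0] q (- q * exp t))"
  unfolding ramanujan_eq_def
  \<comment> \<open>With no upper and one lower parameter \<open>d\<close> is 2, which produces the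
    single linear term \<open>q y\<^sup>2\<close>.\<close>
  by (rule qphi_solves[where d = 2 and \<mu> = 1])
     (use q in \<open>simp_all add: algebra_simps power2_eq_square\<close>)

end

theorem theorem4p3:
  fixes q a0 a1 a2 b0 b1 b2 :: complex and E :: qeq
  assumes q: "0 < norm q" "norm q < 1"
    and E: "E = QEq a0 b0 a1 b1 a2 b2"
    and hypergeometric_type: "second_order E" "nondegenerate E"
  shows
    \<comment> \<open>every equation reduces to one in the list\<close>
    "((\<exists>a b c. reduces q E (heine_eq q a b c)) \<or>
      (\<exists>a c. reduces q E (phi11_eq q a c)) \<or>
      (\<exists>\<nu>. reduces q E (bessel_E1_eq q \<nu>)) \<or>
      (\<exists>\<nu>. reduces q E (bessel_E3_eq q \<nu>)) \<or>
      (\<exists>a. reduces q E (hermite_weber_eq a)) \<or>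
      reduces q E airy_eq \<or>
      reduces q E (ramanujan_eq q))
    \<and> \<comment> \<open>the cases\<close>
     (a0 * a2 * b0 * b2 \<noteq> 0 \<longrightarrow> (\<exists>a b c. reduces q E (heine_eq q a b c))) \<and>
     (b2 = 0 \<and> a0 * a2 * b0 * b1 \<noteq> 0 \<longrightarrow> (\<exists>a c. reduces q E (phi11_eq q a c))) \<and>
     (b0 = 0 \<and> b1 = 0 \<and> a0 * a1 * a2 * b2 \<noteq> 0 \<longrightarrow> (\<exists>\<nu>. reduces q E (bessel_E1_eq q \<nu>))) \<and>
     (b0 = 0 \<and> b2 = 0 \<and> a0 * a1 * a2 * b1 \<noteq> 0 \<longrightarrow> (\<exists>\<nu>. reduces q E (bessel_E3_eq q \<nu>))) \<and>
     (b2 = 0 \<and> a0 = 0 \<and> a1 * a2 * b0 * b1 \<noteq> 0 \<longrightarrow> (\<exists>a. reduces q E (hermite_weber_eq a))) \<and>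
     (b0 = 0 \<and> a1 = 0 \<and> b2 = 0 \<longrightarrow> reduces q E airy_eq) \<and>
     (a0 = 0 \<and> b1 = 0 \<and> b2 = 0 \<longrightarrow> reduces q E (ramanujan_eq q))
    \<and> \<comment> \<open>the named functions solve the equations of the list\<close>
     (\<forall>a b c. (\<forall>k. c * q ^ k \<noteq> 1) \<longrightarrow>
        solves_on q {t. norm (exp t) < 1} (heine_eq q a b c) (\<lambda>t. qphi [a, b] [c] q (exp t))) \<and>
     (\<forall>a c. (\<forall>k. c * q ^ k \<noteq> 1) \<longrightarrow>
        solves_on q UNIV (phi11_eq q a c) (\<lambda>t. qphi [a] [c] q (exp t))) \<and>
     (\<forall>\<nu>. (\<forall>k. q powr (2 * \<nu> + 1) * q ^ k \<noteq> 1) \<longrightarrow>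
        solves_on q {t. norm (exp t) < 4} (bessel_E1_eq q \<nu>) (bessel_E1 q \<nu>)) \<and>
     (\<forall>\<nu>. (\<forall>k. q powr (2 * \<nu> + 1) * q ^ k \<noteq> 1) \<longrightarrow>
        solves_on q UNIV (bessel_E3_eq q \<nu>) (bessel_E3 q \<nu>)) \<and>
     (\<forall>a. solves_on q UNIV (hermite_weber_eq a) (\<lambda>t. qphi [a] [0] q (exp t))) \<and>
     solves_on q UNIV airy_eq (\<lambda>t. qphi [0] [- q] q (- exp t)) \<and>
     solves_on q UNIV (ramanujan_eq q) (\<lambda>t. qphi [] [0] q (- q * exp t))"
proof -
  \<comment> \<open>In this case and the next, the nonvanishing of the other three coefficients
    comes from second order and nondegeneracy.\<close>
  have airy: "b0 = 0 \<and> a1 = 0 \<and> b2 = 0 \<longrightarrow> reduces q E airy_eq"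
  proof
    assume zero: "b0 = 0 \<and> a1 = 0 \<and> b2 = 0"
    then have "a0 \<noteq> 0" "a2 \<noteq> 0" "b1 \<noteq> 0"
      using hypergeometric_type unfolding E by simp_all
    from reduces_airy[OF q this] show "reduces q E airy_eq" using zero by (simp add: E)
  qed
  have ramanujan: "a0 = 0 \<and> b1 = 0 \<and> b2 = 0 \<longrightarrow> reduces q E (ramanujan_eq q)"
  proof
    assume zero: "a0 = 0 \<and> b1 = 0 \<and> b2 = 0"
    then have "a1 \<noteq> 0" "a2 \<noteq> 0" "b0 \<noteq> 0"
      using hypergeometric_type unfolding E by auto
    from reduces_ramanujan[OF q this] show "reduces q E (ramanujan_eq q)" using zero by (simp add: E)
  qed
  have heine: "a0 * a2 * b0 * b2 \<noteq> 0 \<longrightarrow> (\<exists>a b c. reduces q E (heine_eq q a b c))"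
    unfolding E using reduces_heine[OF q] by simp
  have phi11: "b2 = 0 \<and> a0 * a2 * b0 * b1 \<noteq> 0 \<longrightarrow> (\<exists>a c. reduces q E (phi11_eq q a c))"
    unfolding E using reduces_phi11[OF q] by simp
  have bessel_E1: "b0 = 0 \<and> b1 = 0 \<and> a0 * a1 * a2 * b2 \<noteq> 0 \<longrightarrow> (\<exists>\<nu>. reduces q E (bessel_E1_eq q \<nu>))"
    unfolding E using reduces_bessel_E1[OF q] by simp
  have bessel_E3: "b0 = 0 \<and> b2 = 0 \<and> a0 * a1 * a2 * b1 \<noteq> 0 \<longrightarrow> (\<exists>\<nu>. reduces q E (bessel_E3_eq q \<nu>))"
    unfolding E using reduces_bessel_E3[OF q] by simp
  have hermite_weber: "b2 = 0 \<and> a0 = 0 \<and> a1 * a2 * b0 * b1 \<noteq> 0 \<longrightarrow> (\<exists>a. reduces q E (hermite_weber_eq a))"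
    unfolding E using reduces_hermite_weber[OF q] by simp
  show ?thesis
    by (intro conjI;
        (rule reducible[OF q hypergeometric_type, unfolded reducible_def[OF q]]
            heine phi11 bessel_E1 bessel_E3 hermite_weber airy ramanujan
          | (intro allI impI)?,
            rule solves_heine[OF q] solves_phi11[OF q] solves_bessel_E1[OF q] solves_bessel_E3[OF q]
              solves_hermite_weber[OF q] solves_airy[OF q] solves_ramanujan[OF q],
            (erule spec)?))
qed

end
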